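(* For every special tree $T$, the ray space $\mathcal{R}(T)$ contains a dense, completely metrizable subspace.
   Context: A tree is a partially ordered set $T$ with a unique minimal element such that the set of predecessors of any element is well-ordered (distinct limit nodes may have the same set of strict predecessors). A tree is special if it is a union of countably many antichains. A path in $T$ is a nonempty down-closed chain; a ray is a path without maximal element. The ray space $\mathcal{R}(T)$ is the set of all rays of $T$ with the subspace topology inherited from $2^T$ (product topology), rays being identified with their characteristic functions. *)

theory Defs
  imports "HOL-Analysis.Analysis"
begin

text \<open>A partially ordered set is a carrier \<open>T\<close> with an order relation \<open>r\<close>, where
  \<open>(s, t) \<in> r\<close> means \<open>s \<le> t\<close>.\<close>

definition strict_preds :: "'a set \<Rightarrow> 'a rel \<Rightarrow> 'a \<Rightarrow> 'a set" where
  "strict_preds T r t = {s \<in> T. (s, t) \<in> r \<and> s \<noteq> t}"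

text \<open>No Hausdorff condition: distinct nodes of limit height may have the same strict
  predecessors.\<close>

definition is_tree :: "'a set \<Rightarrow> 'a rel \<Rightarrow> bool" where
  "is_tree T r \<longleftrightarrow>
     partial_order_on T r \<and>
     (\<exists>!m. m \<in> T \<and> (\<forall>s\<in>T. (s, m) \<in> r \<longrightarrow> s = m)) \<and>
     (\<forall>t\<in>T. well_order_on (strict_preds T r t) (Restr r (strict_preds T r t)))"

definition antichain_in :: "'a set \<Rightarrow> 'a rel \<Rightarrow> 'a set \<Rightarrow> bool" where
  "antichain_in T r A \<longleftrightarrow> A \<subseteq> T \<and> (\<forall>s\<in>A. \<forall>t\<in>A. (s, t) \<in> r \<longrightarrow> s = t)"

definition special_tree :: "'a set \<Rightarrow> 'a rel \<Rightarrow> bool" where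
  "special_tree T r \<longleftrightarrow>
     is_tree T r \<and> (\<exists>\<A>. countable \<A> \<and> (\<forall>A\<in>\<A>. antichain_in T r A) \<and> \<Union>\<A> = T)"

definition tree_path :: "'a set \<Rightarrow> 'a rel \<Rightarrow> 'a set \<Rightarrow> bool" where
  "tree_path T r P \<longleftrightarrow>
     P \<noteq> {} \<and> P \<subseteq> T \<and> P \<in> Chains r \<and> (\<forall>t\<in>P. \<forall>s\<in>T. (s, t) \<in> r \<longrightarrow> s \<in> P)"

definition rays :: "'a set \<Rightarrow> 'a rel \<Rightarrow> 'a set set" where
  "rays T r = {P. tree_path T r P \<and> \<not> (\<exists>m\<in>P. \<forall>t\<in>P. (m, t) \<in> r \<longrightarrow> t = m)}"

text \<open>Points of the product topology over \<open>T\<close> are extensional on \<open>T\<close>, so characteristic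
  functions are restricted to \<open>T\<close> (not extended by \<open>False\<close>).\<close>

definition char_fun :: "'a set \<Rightarrow> 'a set \<Rightarrow> 'a \<Rightarrow> bool" where
  "char_fun T P = restrict (\<lambda>t. t \<in> P) T"

definition ray_space :: "'a set \<Rightarrow> 'a rel \<Rightarrow> ('a \<Rightarrow> bool) topology" where
  "ray_space T r =
     subtopology (product_topology (\<lambda>_. discrete_topology UNIV) T) (char_fun T ` rays T r)"

end

theory Submission
  imports Defs
begin

text \<open>Write the tree as a union of antichains \<open>A 0, A 1, \<dots>\<close>. A ray meets each \<open>A n\<close> in at most one
  node, so it is encoded by the sequence of these nodes. The sequences arising in this way form a
  \<open>G\<^sub>\<delta>\<close> set in a countable product of discrete spaces, and decoding is a continuous bijection from it
  onto the ray space. Its inverse is continuous on the set \<open>D\<close> of those rays that, for every \<open>n\<close>,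
  meet \<open>A n\<close> or have a neighbourhood of rays missing \<open>A n\<close>; since \<open>D\<close> is a \<open>G\<^sub>\<delta>\<close> set, it is completely
  metrizable. For density, consider the rays that contain a node \<open>t\<close> and avoid a finite set \<open>F\<close>. Keep
  \<open>F\<close> fixed and climb from \<open>t\<close>, at step \<open>n\<close> passing a node of \<open>A n\<close> whenever some ray
  still under consideration does so; the nodes climbed generate a ray in \<open>D\<close>.\<close>

section \<open>Countable intersections, local constancy and transfer of complete
  metrizability\<close>

lemma gdelta_in_Collect_all:
  fixes P :: "nat \<Rightarrow> 'b \<Rightarrow> bool"
  assumes "\<And>n. gdelta_in X {x. P n x}"
  shows "gdelta_in X {x. \<forall>n. P n x}"
proof -
  have "{x. \<forall>n. P n x} = (\<Inter>n. {x. P n x})"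
    by auto
  then show ?thesis
    using assms by (auto intro: gdelta_in_Inter)
qed

text \<open>Serves for the coordinates of both decoding and encoding, which are shown to be locally
  constant.\<close>

lemma continuous_map_into_discrete:
  assumes "\<And>x. x \<in> topspace X \<Longrightarrow> \<exists>U. openin X U \<and> x \<in> U \<and> (\<forall>y\<in>U. f y = f x)"
  shows "continuous_map X (discrete_topology UNIV) f"
  unfolding continuous_map
proof (intro conjI allI impI)
  fix V
  let ?S = "{x \<in> topspace X. f x \<in> V}"
  have "\<exists>U. openin X U \<and> x \<in> U \<and> U \<subseteq> ?S" if x: "x \<in> ?S" for x
  proof -
    from x assms obtain U where U: "openin X U" "x \<in> U" "\<forall>y\<in>U. f y = f x"
      by blast
    have "U \<subseteq> ?S"
    proof
      fix y assume "y \<in> U"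
      with U(3) have "f y = f x"
        by (rule bspec)
      with x openin_subset[OF U(1)] \<open>y \<in> U\<close> show "y \<in> ?S"
        by auto
    qed
    with U show ?thesis
      by blast
  qed
  then show "openin X ?S"
    using openin_subopen by blast
qed simp

text \<open>The preimage of \<open>D\<close> under \<open>g\<close> is again a countable
  intersection of open sets, hence completely metrizable. On it \<open>g\<close> is a homeomorphism
  onto \<open>D\<close> with inverse \<open>e\<close>. Only the part of \<open>Y\<close> lying over
  \<open>D\<close> matters, so \<open>e\<close> has to be continuous on \<open>D\<close>
  alone.\<close>

lemma completely_metrizable_space_bijection:
  assumes "completely_metrizable_space Y"
    and "continuous_map Y X g"
    and "gdelta_in X D"
    and "continuous_map (subtopology X D) Y e"
    and "\<And>y. y \<in> topspace Y \<Longrightarrow> e (g y) = y"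
    and "\<And>x. x \<in> D \<Longrightarrow> g (e x) = x"
  shows "completely_metrizable_space (subtopology X D)"
proof -
  let ?E = "{y \<in> topspace Y. g y \<in> D}"
  have DX: "D \<subseteq> topspace X"
    using assms(3) by (rule gdelta_in_subset)
  obtain \<U> where U: "countable \<U>" "\<And>U. U \<in> \<U> \<Longrightarrow> openin X U" "\<Inter>\<U> = D"
    using assms(3) by (auto simp: gdelta_in_alt intersection_of_def)
  \<comment> \<open>Inserting \<open>topspace Y\<close> keeps the family nonempty if \<U> is empty
    and keeps the intersection inside the space.\<close>
  have "gdelta_in Y (\<Inter>(insert (topspace Y) ((\<lambda>U. {y \<in> topspace Y. g y \<in> U}) ` \<U>)))"
    using U assms(2)
    by (intro gdelta_in_Inter)
       (auto intro!: open_imp_gdelta_in openin_continuous_map_preimage)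
  moreover have "\<Inter>(insert (topspace Y) ((\<lambda>U. {y \<in> topspace Y. g y \<in> U}) ` \<U>)) = ?E"
    using U(3) by auto
  ultimately have cm: "completely_metrizable_space (subtopology Y ?E)"
    using assms(1) completely_metrizable_space_gdelta_in by metis
  have eY: "e x \<in> topspace Y" if "x \<in> D" for x
    using assms(4) that DX by (auto simp: continuous_map_def Pi_iff)
  have "homeomorphic_maps (subtopology Y ?E) (subtopology X D) g e"
    unfolding homeomorphic_maps_def
  proof (intro conjI)
    show "continuous_map (subtopology Y ?E) (subtopology X D) g"
      by (intro continuous_map_into_subtopology continuous_map_from_subtopology assms(2)) simp
    show "continuous_map (subtopology X D) (subtopology Y ?E) e"
      using assms(4) by (rule continuous_map_into_subtopology) (simp add: eY assms(6))
  qed (simp_all add: assms(5,6))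
  then have "subtopology Y ?E homeomorphic_space subtopology X D"
    unfolding homeomorphic_space_def by blast
  then show ?thesis
    using cm homeomorphic_completely_metrizable_space by blast
qed

section \<open>Rays as points of the product space\<close>

definition node_set :: "'a set \<Rightarrow> ('a \<Rightarrow> bool) \<Rightarrow> 'a set" where
  "node_set T f = {t \<in> T. f t}"

lemma node_set_char_fun [simp]: "P \<subseteq> T \<Longrightarrow> node_set T (char_fun T P) = P"
  by (auto simp: node_set_def char_fun_def)

lemma char_fun_apply: "t \<in> T \<Longrightarrow> char_fun T P t \<longleftrightarrow> t \<in> P"
  by (simp add: char_fun_def)

lemma topspace_ray_space: "topspace (ray_space T r) = char_fun T ` rays T r"
  by (auto simp: ray_space_def char_fun_def)

lemma rays_subset: "P \<in> rays T r \<Longrightarrow> P \<subseteq> T"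
  by (auto simp: rays_def tree_path_def)

lemma node_set_in_rays: "f \<in> topspace (ray_space T r) \<Longrightarrow> node_set T f \<in> rays T r"
  by (auto simp: topspace_ray_space rays_subset)

lemma char_fun_node_set: "f \<in> topspace (ray_space T r) \<Longrightarrow> char_fun T (node_set T f) = f"
  by (auto simp: topspace_ray_space rays_subset)

text \<open>Both truth values occur later: \<open>True\<close> for rays through a node,
  \<open>False\<close> for rays avoiding one.\<close>

lemma openin_ray_space_contains:
  assumes "t \<in> T"
  shows "openin (ray_space T r) {f \<in> topspace (ray_space T r). f t = b}"
proof -
  have "continuous_map (ray_space T r) (discrete_topology UNIV) (\<lambda>f. f t)"
    unfolding ray_space_def
    by (intro continuous_map_from_subtopology continuous_map_product_projection assms)
  from openin_continuous_map_preimage[OF this, of "{b}"] show ?thesis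
    by simp
qed

section \<open>Order properties of rays in a poset covered by antichains\<close>

locale antichain_cover =
  fixes T :: "'a set" and r :: "'a rel" and A :: "nat \<Rightarrow> 'a set"
  assumes po: "partial_order_on T r"
    and antichain: "\<And>n. antichain_in T r (A n)"
    and cover: "(\<Union>n. A n) = T"
begin

abbreviation R :: "('a \<Rightarrow> bool) topology" where
  "R \<equiv> ray_space T r"

lemma order_refl: "t \<in> T \<Longrightarrow> (t, t) \<in> r"
  and order_antisym: "(s, t) \<in> r \<Longrightarrow> (t, s) \<in> r \<Longrightarrow> s = t"
  and order_trans: "(s, t) \<in> r \<Longrightarrow> (t, u) \<in> r \<Longrightarrow> (s, u) \<in> r"
  and order_carrier: "(s, t) \<in> r \<Longrightarrow> s \<in> T \<and> t \<in> T"
  using po by (auto simp: partial_order_on_def preorder_on_def refl_on_def antisym_def dest: transD)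

lemma A_subset: "s \<in> A n \<Longrightarrow> s \<in> T"
  using cover by blast

lemma A_unique: "s \<in> A n \<Longrightarrow> t \<in> A n \<Longrightarrow> (s, t) \<in> r \<Longrightarrow> s = t"
  using antichain by (auto simp: antichain_in_def)

lemma obtain_level:
  assumes "t \<in> T"
  obtains n where "t \<in> A n"
  using assms cover by blast

lemma ray_chain: "P \<in> rays T r \<Longrightarrow> s \<in> P \<Longrightarrow> t \<in> P \<Longrightarrow> (s, t) \<in> r \<or> (t, s) \<in> r"
  by (auto simp: rays_def tree_path_def Chains_def)

lemma ray_down: "P \<in> rays T r \<Longrightarrow> t \<in> P \<Longrightarrow> (s, t) \<in> r \<Longrightarrow> s \<in> P"
  using order_carrier by (fastforce simp: rays_def tree_path_def)

lemma ray_above: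
  assumes "P \<in> rays T r" "s \<in> P"
  obtains t where "t \<in> P" "(s, t) \<in> r" "t \<noteq> s"
  using assms by (auto simp: rays_def)

text \<open>If \<open>s\<close> lies below \<open>t\<close>, any node of the ray strictly above
  \<open>t\<close> will do; otherwise \<open>s\<close> itself is strictly above \<open>t\<close>.
  Strictness over \<open>t\<close> later makes each step of the climb proper.\<close>

lemma ray_above_two:
  assumes "P \<in> rays T r" "s \<in> P" "t \<in> P"
  obtains u where "u \<in> P" "(s, u) \<in> r" "(t, u) \<in> r" "u \<noteq> t"
proof (cases "(s, t) \<in> r")
  case True
  then show ?thesis
    using that ray_above[OF assms(1,3)] order_trans by metis
next
  case False
  then have "(t, s) \<in> r" "t \<noteq> s"
    using ray_chain[OF assms] order_refl rays_subset assms by blast+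
  then show ?thesis
    using that assms(2) order_refl order_carrier by metis
qed

lemma ray_finite_bound:
  assumes "P \<in> rays T r" "finite I" "I \<subseteq> P"
  obtains t where "t \<in> P" "\<And>s. s \<in> I \<Longrightarrow> (s, t) \<in> r"
proof -
  have "\<exists>t\<in>P. \<forall>s\<in>I. (s, t) \<in> r"
    using assms(2,3)
  proof (induction I rule: finite_induct)
    case empty
    then show ?case
      using assms(1) by (auto simp: rays_def tree_path_def)
  next
    case (insert a I)
    then obtain t where "t \<in> P" "\<forall>s\<in>I. (s, t) \<in> r" "a \<in> P"
      by auto
    moreover obtain u where "u \<in> P" "(a, u) \<in> r" "(t, u) \<in> r"
      using ray_above_two[OF assms(1)] calculation by metis
    ultimately show ?case
      using order_trans by (metis insert_iff)
  qed
  then show ?thesis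
    using that by blast
qed

lemma raysI:
  assumes "P \<noteq> {}" "P \<subseteq> T"
    and "\<And>s t. s \<in> P \<Longrightarrow> t \<in> P \<Longrightarrow> (s, t) \<in> r \<or> (t, s) \<in> r"
    and "\<And>s t. t \<in> P \<Longrightarrow> (s, t) \<in> r \<Longrightarrow> s \<in> P"
    and "\<And>s. s \<in> P \<Longrightarrow> \<exists>t\<in>P. (s, t) \<in> r \<and> t \<noteq> s"
  shows "P \<in> rays T r"
  unfolding rays_def tree_path_def Chains_def using assms by blast

section \<open>Coding rays by sequences of nodes\<close>

abbreviation code_space :: "(nat \<Rightarrow> 'a option) topology" where
  "code_space \<equiv> product_topology (\<lambda>_. discrete_topology UNIV) UNIV"

text \<open>The clauses express nonemptiness, compatibility with the antichains, down-closure,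
  linearity and absence of a maximal node. Their form is chosen for the topology: quantifiers over
  indices stand outside, while those over the possibly uncountably many nodes only describe a
  relation between two coordinates. For this reason \<open>m\<close> precedes \<open>s\<close> in
  the last clause, which loses nothing because \<open>n\<close> already determines
  \<open>s\<close>.\<close>

definition codes :: "(nat \<Rightarrow> 'a option) set" where
  "codes = {\<sigma>. (\<exists>n. \<sigma> n \<noteq> None) \<and>
     (\<forall>n s. \<sigma> n = Some s \<longrightarrow> s \<in> A n) \<and>
     (\<forall>n m. \<forall>s u. \<sigma> n = Some s \<and> u \<in> A m \<and> (u, s) \<in> r \<longrightarrow> \<sigma> m = Some u) \<and>
     (\<forall>n m. \<forall>s u. \<sigma> n = Some s \<and> \<sigma> m = Some u \<longrightarrow> (s, u) \<in> r \<or> (u, s) \<in> r) \<and>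
     (\<forall>n. \<exists>m. \<forall>s. \<sigma> n = Some s \<longrightarrow> (\<exists>u. \<sigma> m = Some u \<and> (s, u) \<in> r \<and> u \<noteq> s))}"

definition decode :: "(nat \<Rightarrow> 'a option) \<Rightarrow> 'a set" where
  "decode \<sigma> = {s. \<exists>n. \<sigma> n = Some s}"

definition encode :: "'a set \<Rightarrow> nat \<Rightarrow> 'a option" where
  "encode P n = (if P \<inter> A n = {} then None else Some (THE s. s \<in> P \<inter> A n))"

text \<open>Two nodes of a ray in the same antichain are comparable, hence equal, so the definite
  description in \<open>encode\<close> is well defined.\<close>

lemma encode_eq_Some_iff:
  assumes "P \<in> rays T r"
  shows "encode P n = Some s \<longleftrightarrow> s \<in> P \<inter> A n"
proof -
  have uniq: "s = u" if "s \<in> P \<inter> A n" "u \<in> P \<inter> A n" for s u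
    using ray_chain[OF assms, of s u] A_unique that by blast
  have "(THE s. s \<in> P \<inter> A n) = u" if "u \<in> P \<inter> A n" for u
    using that uniq by (intro the_equality) auto
  then show ?thesis
    unfolding encode_def by (cases "P \<inter> A n = {}") auto
qed

lemma decode_encode:
  assumes "P \<in> rays T r"
  shows "decode (encode P) = P"
  using cover rays_subset[OF assms] by (auto simp: decode_def encode_eq_Some_iff[OF assms])

lemma encode_in_codes:
  assumes P: "P \<in> rays T r"
  shows "encode P \<in> codes"
proof -
  note iff = encode_eq_Some_iff[OF P]
  obtain t where "t \<in> P"
    using P by (auto simp: rays_def tree_path_def)
  then have "\<exists>n. encode P n \<noteq> None"
    using decode_encode[OF P] by (force simp: decode_def)
  moreover have "\<forall>n s. encode P n = Some s \<longrightarrow> s \<in> A n"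
    by (simp add: iff)
  moreover have "\<forall>n m. \<forall>s u. encode P n = Some s \<and> u \<in> A m \<and> (u, s) \<in> r \<longrightarrow> encode P m = Some u"
    using ray_down[OF P] unfolding iff by blast
  moreover have "\<forall>n m. \<forall>s u. encode P n = Some s \<and> encode P m = Some u \<longrightarrow> (s, u) \<in> r \<or> (u, s) \<in> r"
    using ray_chain[OF P] unfolding iff by blast
  moreover have "\<forall>n. \<exists>m. \<forall>s. encode P n = Some s \<longrightarrow>
      (\<exists>u. encode P m = Some u \<and> (s, u) \<in> r \<and> u \<noteq> s)"
  proof
    fix n
    show "\<exists>m. \<forall>s. encode P n = Some s \<longrightarrow>
      (\<exists>u. encode P m = Some u \<and> (s, u) \<in> r \<and> u \<noteq> s)"
    proof (cases "encode P n")
      case (Some s)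
      then have "s \<in> P"
        using iff by simp
      then obtain u where u: "u \<in> P" "(s, u) \<in> r" "u \<noteq> s"
        by (rule ray_above[OF P])
      then obtain m where "u \<in> A m"
        using order_carrier obtain_level[of u] by blast
      then have "encode P m = Some u"
        using u iff by simp
      then show ?thesis
        using Some u by auto
    qed simp
  qed
  ultimately show ?thesis
    unfolding codes_def mem_Collect_eq by (intro conjI)
qed

lemma codes_mem: "\<sigma> \<in> codes \<Longrightarrow> \<sigma> n = Some s \<Longrightarrow> s \<in> A n"
  and codes_down: "\<sigma> \<in> codes \<Longrightarrow> \<sigma> n = Some s \<Longrightarrow> u \<in> A m \<Longrightarrow> (u, s) \<in> r \<Longrightarrow> \<sigma> m = Some u"
  and codes_chain: "\<sigma> \<in> codes \<Longrightarrow> \<sigma> n = Some s \<Longrightarrow> \<sigma> m = Some u \<Longrightarrow> (s, u) \<in> r \<or> (u, s) \<in> r"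
  and codes_succ: "\<sigma> \<in> codes \<Longrightarrow> \<sigma> n = Some s \<Longrightarrow> \<exists>m u. \<sigma> m = Some u \<and> (s, u) \<in> r \<and> u \<noteq> s"
  and codes_nonempty: "\<sigma> \<in> codes \<Longrightarrow> \<exists>n. \<sigma> n \<noteq> None"
  unfolding codes_def by blast+

text \<open>The antichains may overlap, so \<open>t\<close> might a priori be recorded at another
  index only. Down-closure of codes, applied to \<open>t\<close> below itself, forces it to be
  recorded at every \<open>n\<close> with \<open>t\<close> in \<open>A n\<close>.\<close>

lemma mem_decode_iff:
  assumes "\<sigma> \<in> codes" "t \<in> A n"
  shows "t \<in> decode \<sigma> \<longleftrightarrow> \<sigma> n = Some t"
proof
  assume "t \<in> decode \<sigma>"
  then obtain m where "\<sigma> m = Some t"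
    by (auto simp: decode_def)
  then show "\<sigma> n = Some t"
    using codes_down[OF assms(1) _ assms(2)] order_refl A_subset[OF assms(2)] by blast
qed (auto simp: decode_def)

lemma decode_in_rays:
  assumes \<sigma>: "\<sigma> \<in> codes"
  shows "decode \<sigma> \<in> rays T r"
proof (rule raysI)
  show "decode \<sigma> \<noteq> {}"
    using codes_nonempty[OF \<sigma>] by (auto simp: decode_def)
  show "decode \<sigma> \<subseteq> T"
    using codes_mem[OF \<sigma>] A_subset by (auto simp: decode_def)
  show "(s, t) \<in> r \<or> (t, s) \<in> r" if "s \<in> decode \<sigma>" "t \<in> decode \<sigma>" for s t
    using that codes_chain[OF \<sigma>] unfolding decode_def by blast
  show "s \<in> decode \<sigma>" if t: "t \<in> decode \<sigma>" and st: "(s, t) \<in> r" for s t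
  proof -
    obtain m where "s \<in> A m"
      using obtain_level order_carrier[OF st] by blast
    then show ?thesis
      using t st codes_down[OF \<sigma>] unfolding decode_def by blast
  qed
  show "\<exists>t\<in>decode \<sigma>. (s, t) \<in> r \<and> t \<noteq> s" if s: "s \<in> decode \<sigma>" for s
  proof -
    obtain n where "\<sigma> n = Some s"
      using s by (auto simp: decode_def)
    then show ?thesis
      using codes_succ[OF \<sigma>] unfolding decode_def by blast
  qed
qed

lemma encode_decode:
  assumes "\<sigma> \<in> codes"
  shows "encode (decode \<sigma>) = \<sigma>"
proof
  fix n
  have "encode (decode \<sigma>) n = Some s \<longleftrightarrow> \<sigma> n = Some s" for s
    unfolding encode_eq_Some_iff[OF decode_in_rays[OF assms]]
    using mem_decode_iff[OF assms] codes_mem[OF assms] by auto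
  then show "encode (decode \<sigma>) n = \<sigma> n"
    by (metis option.exhaust)
qed

text \<open>Any relation between two coordinates is a union of conditions prescribing both values,
  and these are open because the factors are discrete.\<close>

lemma openin_code_space_coordinates:
  "openin code_space {\<sigma>. Q (\<sigma> n) (\<sigma> m)}"
proof -
  have "openin code_space {\<sigma>. \<sigma> k = a}" for k a
    using openin_continuous_map_preimage
      [OF continuous_map_product_projection[of k UNIV "\<lambda>_. discrete_topology UNIV"], of "{a}"]
    by simp
  then have "openin code_space (\<Union>(a, b)\<in>{(a, b). Q a b}. {\<sigma>. \<sigma> n = a} \<inter> {\<sigma>. \<sigma> m = b})"
    by (intro openin_Union) (auto intro!: openin_Int)
  also have "(\<Union>(a, b)\<in>{(a, b). Q a b}. {\<sigma>. \<sigma> n = a} \<inter> {\<sigma>. \<sigma> m = b}) = {\<sigma>. Q (\<sigma> n) (\<sigma> m)}"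
    by auto
  finally show ?thesis .
qed

lemma openin_code_space_ex:
  assumes "\<And>m::nat. openin code_space {\<sigma>. Q m \<sigma>}"
  shows "openin code_space {\<sigma>. \<exists>m. Q m \<sigma>}"
proof -
  have "{\<sigma>. \<exists>m. Q m \<sigma>} = (\<Union>m. {\<sigma>. Q m \<sigma>})"
    by auto
  then show ?thesis
    using assms by auto
qed

text \<open>Each clause is a condition on at most two coordinates, preceded by quantifiers over
  \<open>nat\<close>: existential ones preserve openness, universal ones give countable
  intersections.\<close>

lemma gdelta_in_codes: "gdelta_in code_space codes"
proof -
  have "gdelta_in code_space {\<sigma>. \<exists>n. \<sigma> n \<noteq> None}"
    using openin_code_space_coordinates[of "\<lambda>a b. a \<noteq> None"]
    by (intro open_imp_gdelta_in openin_code_space_ex)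
  moreover have "gdelta_in code_space {\<sigma>. \<forall>n s. \<sigma> n = Some s \<longrightarrow> s \<in> A n}"
    using openin_code_space_coordinates[of "\<lambda>a b. \<forall>s. a = Some s \<longrightarrow> s \<in> A _"]
    by (intro gdelta_in_Collect_all open_imp_gdelta_in)
  moreover have "gdelta_in code_space
      {\<sigma>. \<forall>n m. \<forall>s u. \<sigma> n = Some s \<and> u \<in> A m \<and> (u, s) \<in> r \<longrightarrow> \<sigma> m = Some u}"
    using openin_code_space_coordinates
      [of "\<lambda>a b. \<forall>s u. a = Some s \<and> u \<in> A _ \<and> (u, s) \<in> r \<longrightarrow> b = Some u"]
    by (intro gdelta_in_Collect_all open_imp_gdelta_in)
  moreover have "gdelta_in code_space
      {\<sigma>. \<forall>n m. \<forall>s u. \<sigma> n = Some s \<and> \<sigma> m = Some u \<longrightarrow> (s, u) \<in> r \<or> (u, s) \<in> r}"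
    using openin_code_space_coordinates
      [of "\<lambda>a b. \<forall>s u. a = Some s \<and> b = Some u \<longrightarrow> (s, u) \<in> r \<or> (u, s) \<in> r"]
    by (intro gdelta_in_Collect_all open_imp_gdelta_in)
  moreover have "gdelta_in code_space
      {\<sigma>. \<forall>n. \<exists>m. \<forall>s. \<sigma> n = Some s \<longrightarrow> (\<exists>u. \<sigma> m = Some u \<and> (s, u) \<in> r \<and> u \<noteq> s)}"
    using openin_code_space_coordinates
      [of "\<lambda>a b. \<forall>s. a = Some s \<longrightarrow> (\<exists>u. b = Some u \<and> (s, u) \<in> r \<and> u \<noteq> s)"]
    by (intro gdelta_in_Collect_all open_imp_gdelta_in openin_code_space_ex)
  ultimately show ?thesis
    unfolding codes_def Collect_conj_eq by (intro gdelta_in_Int)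
qed

lemma completely_metrizable_codes: "completely_metrizable_space (subtopology code_space codes)"
  by (intro completely_metrizable_space_gdelta_in gdelta_in_codes)
     (simp add: completely_metrizable_space_product_topology
        completely_metrizable_space_discrete_topology)

text \<open>Whether \<open>t\<close> belongs to the decoded ray is read off from a single
  coordinate, namely any \<open>n\<close> with \<open>t\<close> in \<open>A n\<close>.\<close>

lemma continuous_map_decode:
  "continuous_map (subtopology code_space codes) R (\<lambda>\<sigma>. char_fun T (decode \<sigma>))"
proof -
  have "continuous_map (subtopology code_space codes) (discrete_topology UNIV)
          (\<lambda>\<sigma>. char_fun T (decode \<sigma>) t)" if t: "t \<in> T" for t
  proof -
    obtain n where n: "t \<in> A n"
      using t by (rule obtain_level)
    show ?thesis
    proof (rule continuous_map_into_discrete)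
      fix \<sigma> assume \<sigma>: "\<sigma> \<in> topspace (subtopology code_space codes)"
      let ?U = "codes \<inter> {\<tau>. (\<tau> n = Some t) = (\<sigma> n = Some t)}"
      have "openin (subtopology code_space codes) ?U"
        using openin_code_space_coordinates[of "\<lambda>a b. (a = Some t) = (\<sigma> n = Some t)" n]
        by (rule openin_subtopology_Int2)
      moreover have "\<sigma> \<in> ?U"
        using \<sigma> by simp
      moreover have "\<forall>\<tau>\<in>?U. char_fun T (decode \<tau>) t = char_fun T (decode \<sigma>) t"
        using \<sigma> t n by (auto simp: char_fun_def mem_decode_iff)
      ultimately show "\<exists>U. openin (subtopology code_space codes) U \<and> \<sigma> \<in> U \<and>
          (\<forall>\<tau>\<in>U. char_fun T (decode \<tau>) t = char_fun T (decode \<sigma>) t)"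
        by (intro exI[of _ ?U] conjI)
    qed
  qed
  then have "continuous_map (subtopology code_space codes)
      (product_topology (\<lambda>_. discrete_topology UNIV) T) (\<lambda>\<sigma>. char_fun T (decode \<sigma>))"
    unfolding continuous_map_componentwise by (auto simp: char_fun_def)
  then show ?thesis
    unfolding ray_space_def
    by (rule continuous_map_into_subtopology) (use decode_in_rays in auto)
qed

section \<open>Tame rays and continuity of the encoding\<close>

definition missing :: "nat \<Rightarrow> ('a \<Rightarrow> bool) set" where
  "missing n = {f \<in> topspace R. node_set T f \<inter> A n = {}}"

text \<open>Each \<open>missing n\<close> is closed, so these are the rays lying on the frontier of
  no \<open>missing n\<close>.\<close>

definition tame_rays :: "('a \<Rightarrow> bool) set" where
  "tame_rays = {f \<in> topspace R. \<forall>n. f \<notin> missing n \<or> f \<in> R interior_of missing n}"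

lemma openin_meeting: "openin R {f \<in> topspace R. f \<notin> missing n}"
proof -
  have "openin R (\<Union>s\<in>A n. {f \<in> topspace R. f s = True})"
    using openin_ray_space_contains[OF A_subset] by (intro openin_Union) (blast elim: imageE)
  also have "(\<Union>s\<in>A n. {f \<in> topspace R. f s = True}) = {f \<in> topspace R. f \<notin> missing n}"
    using A_subset by (auto simp: missing_def node_set_def)
  finally show ?thesis .
qed

lemma gdelta_in_tame_rays: "gdelta_in R tame_rays"
proof -
  have "tame_rays = (\<Inter>n. {f \<in> topspace R. f \<notin> missing n} \<union> R interior_of missing n)"
    using interior_of_subset_topspace[of R] by (auto simp: tame_rays_def)
  moreover have "gdelta_in R (\<Inter>n. {f \<in> topspace R. f \<notin> missing n} \<union> R interior_of missing n)"
    by (intro gdelta_in_Inter) (auto intro!: open_imp_gdelta_in openin_Un openin_meeting)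
  ultimately show ?thesis
    by simp
qed

text \<open>If the ray meets \<open>A n\<close> in \<open>s\<close>, every ray through
  \<open>s\<close> has the same coordinate \<open>Some s\<close>. If it misses \<open>A n\<close>,
  tameness supplies a neighbourhood on which the coordinate is constantly
  \<open>None\<close>.\<close>

lemma continuous_map_encode:
  "continuous_map (subtopology R tame_rays) (subtopology code_space codes) (\<lambda>f. encode (node_set T f))"
proof -
  have "continuous_map (subtopology R tame_rays) (discrete_topology UNIV)
          (\<lambda>f. encode (node_set T f) n)" for n
  proof (rule continuous_map_into_discrete)
    fix f assume "f \<in> topspace (subtopology R tame_rays)"
    then have f: "f \<in> topspace R" "f \<in> tame_rays"
      by auto
    have "\<exists>U. openin R U \<and> f \<in> U \<and> (\<forall>h\<in>U. encode (node_set T h) n = encode (node_set T f) n)"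
    proof (cases "f \<in> missing n")
      case True
      then have "f \<in> R interior_of missing n"
        using f by (auto simp: tame_rays_def)
      moreover have "\<forall>h\<in>R interior_of missing n. encode (node_set T h) n = encode (node_set T f) n"
        using True interior_of_subset[of R "missing n"] by (auto simp: missing_def encode_def)
      ultimately show ?thesis
        by (intro exI[of _ "R interior_of missing n"] conjI openin_interior_of)
    next
      case False
      then obtain s where s: "s \<in> node_set T f \<inter> A n"
        using f by (auto simp: missing_def)
      let ?U = "{h \<in> topspace R. h s = True}"
      have "encode (node_set T h) n = Some s" if "h \<in> ?U" for h
        using that s by (auto simp: encode_eq_Some_iff node_set_in_rays) (auto simp: node_set_def)
      moreover have "f \<in> ?U"
        using s f by (auto simp: node_set_def)
      moreover have "openin R ?U"
        using s by (intro openin_ray_space_contains) (auto simp: node_set_def)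
      ultimately show ?thesis
        by (intro exI[of _ ?U]) simp
    qed
    then obtain U where U: "openin R U" "f \<in> U"
      "\<forall>h\<in>U. encode (node_set T h) n = encode (node_set T f) n"
      by (elim exE conjE)
    show "\<exists>U. openin (subtopology R tame_rays) U \<and> f \<in> U \<and>
        (\<forall>h\<in>U. encode (node_set T h) n = encode (node_set T f) n)"
    proof (intro exI conjI ballI)
      show "openin (subtopology R tame_rays) (tame_rays \<inter> U)"
        using U(1) by (rule openin_subtopology_Int2)
      show "f \<in> tame_rays \<inter> U"
        using f(2) U(2) by (rule IntI)
      show "encode (node_set T h) n = encode (node_set T f) n" if "h \<in> tame_rays \<inter> U" for h
        using U(3) that by (rule bspec[OF _ IntD2])
    qed
  qed
  then have "continuous_map (subtopology R tame_rays) code_space (\<lambda>f. encode (node_set T f))"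
    by (simp add: continuous_map_componentwise_UNIV)
  then show ?thesis
    by (rule continuous_map_into_subtopology) (simp add: Pi_iff encode_in_codes node_set_in_rays)
qed

lemma completely_metrizable_tame_rays: "completely_metrizable_space (subtopology R tame_rays)"
proof (rule completely_metrizable_space_bijection[OF completely_metrizable_codes
      continuous_map_decode gdelta_in_tame_rays continuous_map_encode])
  fix \<sigma> assume "\<sigma> \<in> topspace (subtopology code_space codes)"
  then have "\<sigma> \<in> codes"
    by simp
  then show "encode (node_set T (char_fun T (decode \<sigma>))) = \<sigma>"
    using rays_subset[OF decode_in_rays, of \<sigma>] by (simp add: encode_decode)
next
  fix f assume "f \<in> tame_rays"
  then have f: "f \<in> topspace R"
    by (simp add: tame_rays_def)
  show "char_fun T (decode (encode (node_set T f))) = f"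
    by (simp only: decode_encode[OF node_set_in_rays[OF f]] char_fun_node_set[OF f])
qed

section \<open>Cones of rays and density of the tame rays\<close>

definition cone :: "'a \<Rightarrow> 'a set \<Rightarrow> 'a set set" where
  "cone t F = {P \<in> rays T r. t \<in> P \<and> P \<inter> F = {}}"

lemma openin_cone:
  assumes "t \<in> T" "finite F" "F \<subseteq> T"
  shows "openin R (char_fun T ` cone t F)"
proof -
  have cone_iff: "P \<in> cone t F \<longleftrightarrow>
      P \<in> rays T r \<and> char_fun T P t = True \<and> (\<forall>s\<in>F. char_fun T P s = False)" for P
    using assms by (auto simp: cone_def char_fun_apply subsetD)
  \<comment> \<open>The extra \<open>topspace R\<close> matters for empty \<open>F\<close>, where
    the intersection over \<open>F\<close> alone would be \<open>UNIV\<close>.\<close>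
  have eq: "char_fun T ` cone t F =
      {f \<in> topspace R. f t = True} \<inter> ((\<Inter>s\<in>F. {f \<in> topspace R. f s = False}) \<inter> topspace R)"
    (is "?L = ?M")
  proof
    show "?L \<subseteq> ?M"
      unfolding topspace_ray_space by (auto simp: cone_iff)
    show "?M \<subseteq> ?L"
    proof
      fix f assume f: "f \<in> ?M"
      then obtain P where "P \<in> rays T r" "f = char_fun T P"
        by (auto simp: topspace_ray_space)
      with f have "P \<in> cone t F"
        by (simp add: cone_iff)
      with \<open>f = char_fun T P\<close> show "f \<in> ?L"
        by simp
    qed
  qed
  have avoid: "openin R {f \<in> topspace R. f s = False}" if "s \<in> F" for s
    using that assms(3) by (intro openin_ray_space_contains) (rule subsetD)
  show ?thesis
    unfolding eq
    by (rule openin_Int[OF openin_ray_space_contains[OF assms(1)] openin_INT[OF assms(2) avoid]])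
qed

text \<open>A basic open set restricts only finitely many coordinates \<open>?I\<close>. A node
  \<open>t\<close> of the ray \<open>P\<close> above all of \<open>?I \<inter> P\<close> carries the
  positive information by down-closure, and \<open>F\<close> is the finite rest
  \<open>?I - P\<close>.\<close>

lemma cone_neighbourhood:
  assumes "openin R U" "f \<in> U"
  obtains t F where "finite F" "F \<subseteq> T" "cone t F \<noteq> {}" "char_fun T ` cone t F \<subseteq> U"
proof -
  obtain V where V: "openin (product_topology (\<lambda>_. discrete_topology UNIV) T) V"
      "U = V \<inter> char_fun T ` rays T r"
    using assms(1) by (auto simp: ray_space_def openin_subtopology)
  then obtain W where W: "finite {i \<in> T. W i \<noteq> UNIV}" "f \<in> PiE T W" "PiE T W \<subseteq> V"
    using assms(2) by (fastforce simp: openin_product_topology_alt)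
  obtain P where P: "P \<in> rays T r" "f = char_fun T P"
    using V assms(2) by auto
  let ?I = "{i \<in> T. W i \<noteq> UNIV}"
  obtain t where t: "t \<in> P" "\<And>s. s \<in> ?I \<inter> P \<Longrightarrow> (s, t) \<in> r"
    using ray_finite_bound[OF P(1), of "?I \<inter> P"] W(1) by auto
  have "char_fun T Q \<in> U" if "Q \<in> cone t (?I - P)" for Q
  proof -
    have Q: "Q \<in> rays T r" "t \<in> Q" "Q \<inter> (?I - P) = {}"
      using that by (auto simp: cone_def)
    have "s \<in> Q \<longleftrightarrow> s \<in> P" if "s \<in> ?I" for s
      using that Q t ray_down[OF Q(1,2)] by blast
    then have "char_fun T Q s \<in> W s" if "s \<in> T" for s
      using that W(2) P(2) by (cases "W s = UNIV") (auto simp: char_fun_def PiE_iff)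
    then have "char_fun T Q \<in> PiE T W"
      by (auto simp: PiE_iff char_fun_def)
    then show ?thesis
      using V(2) W(3) Q(1) by auto
  qed
  moreover have "P \<in> cone t (?I - P)"
    using P t by (auto simp: cone_def)
  ultimately show ?thesis
    using that[of "?I - P" t] W(1) by auto
qed

text \<open>A fusion argument: every node of the climb lies on some ray avoiding \<open>F\<close>,
  so the climb never stops, and its down-closure still avoids \<open>F\<close>.\<close>

lemma tame_ray_in_cone:
  assumes "finite F" "F \<subseteq> T" "cone t F \<noteq> {}"
  obtains P where "P \<in> cone t F" "char_fun T P \<in> tame_rays"
proof -
  \<comment> \<open>Step \<open>n\<close> settles the fate of \<open>A n\<close>: either
    \<open>v\<close> has passed one of its nodes, or no ray through \<open>v\<close> avoiding
    \<open>F\<close> meets it any more.\<close>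
  define climbs where "climbs n u v \<longleftrightarrow> (u, v) \<in> r \<and> v \<noteq> u \<and>
      ((\<exists>s\<in>A n. (s, v) \<in> r) \<or> (\<forall>Q\<in>cone v F. Q \<inter> A n = {}))" for n u v
  have step: "\<exists>v. (cone v F \<noteq> {} \<and> (t, v) \<in> r) \<and> climbs n u v"
    if u: "cone u F \<noteq> {} \<and> (t, u) \<in> r" for u n
  proof (cases "\<exists>Q\<in>cone u F. Q \<inter> A n \<noteq> {}")
    case True
    then obtain Q s where Q: "Q \<in> rays T r" "u \<in> Q" "Q \<inter> F = {}" "s \<in> Q" "s \<in> A n"
      by (auto simp: cone_def)
    \<comment> \<open>This \<open>v\<close> lies above the node \<open>s\<close> of
      \<open>A n\<close>, and \<open>Q\<close> itself witnesses that \<open>cone v F\<close> is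
      nonempty.\<close>
    obtain v where "v \<in> Q" "(s, v) \<in> r" "(u, v) \<in> r" "v \<noteq> u"
      using ray_above_two[OF Q(1,4,2)] .
    then show ?thesis
      using Q u order_trans unfolding climbs_def cone_def by blast
  next
    case False
    obtain Q where Q: "Q \<in> rays T r" "u \<in> Q" "Q \<inter> F = {}"
      using u by (auto simp: cone_def)
    obtain v where v: "v \<in> Q" "(u, v) \<in> r" "v \<noteq> u"
      using ray_above[OF Q(1,2)] .
    \<comment> \<open>Cones shrink upwards, so missing \<open>A n\<close> passes from the rays at
      \<open>u\<close> to those at \<open>v\<close>.\<close>
    have "cone v F \<subseteq> cone u F"
      using v(2) ray_down by (auto simp: cone_def)
    then have "climbs n u v"
      using False v unfolding climbs_def by blast
    then show ?thesis
      using Q v u order_trans unfolding cone_def by blast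
  qed
  have "(t, t) \<in> r"
    using assms(3) order_refl rays_subset by (fastforce simp: cone_def)
  then have "\<exists>\<tau>. \<forall>n. (cone (\<tau> n) F \<noteq> {} \<and> (t, \<tau> n) \<in> r) \<and> climbs n (\<tau> n) (\<tau> (Suc n))"
    using assms(3) step by (intro dependent_nat_choice) blast+
  then obtain \<tau> where ne: "\<And>n. cone (\<tau> n) F \<noteq> {}" and t: "\<And>n. (t, \<tau> n) \<in> r"
    and climb: "\<And>n. climbs n (\<tau> n) (\<tau> (Suc n))"
    by blast
  have mono: "(\<tau> m, \<tau> n) \<in> r" if "m \<le> n" for m n
    using that
  proof (induction n rule: dec_induct)
    case base
    then show ?case
      using t order_carrier order_refl by blast
  next
    case (step n)
    then show ?case
      using climb order_trans unfolding climbs_def by blast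
  qed
  \<comment> \<open>Taking the down-closure also captures the nodes of the antichains that were
    passed between climbing points.\<close>
  define P where "P = {s. \<exists>n. (s, \<tau> n) \<in> r}"
  have \<tau>P: "\<tau> n \<in> P" for n
    using mono P_def by blast
  have P: "P \<in> rays T r"
  proof (rule raysI)
    show "P \<noteq> {}"
      using \<tau>P by blast
    show "P \<subseteq> T"
      using order_carrier by (auto simp: P_def)
    show "s \<in> P" if "u \<in> P" "(s, u) \<in> r" for s u
      using that order_trans unfolding P_def by blast
    show "(s, u) \<in> r \<or> (u, s) \<in> r" if su: "s \<in> P" "u \<in> P" for s u
    proof -
      obtain m n where "(s, \<tau> m) \<in> r" "(u, \<tau> n) \<in> r"
        using su by (auto simp: P_def)
      \<comment> \<open>Both nodes lie below a common climbing point; any ray through that point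
        contains both and so makes them comparable.\<close>
      then have "(s, \<tau> (max m n)) \<in> r" "(u, \<tau> (max m n)) \<in> r"
        using order_trans mono[OF max.cobounded1] mono[OF max.cobounded2] by blast+
      moreover obtain Q where "Q \<in> rays T r" "\<tau> (max m n) \<in> Q"
        using ne by (auto simp: cone_def)
      ultimately show ?thesis
        using ray_down ray_chain by meson
    qed
    show "\<exists>u\<in>P. (s, u) \<in> r \<and> u \<noteq> s" if s: "s \<in> P" for s
    proof -
      obtain n where n: "(s, \<tau> n) \<in> r"
        using s by (auto simp: P_def)
      have c: "(\<tau> n, \<tau> (Suc n)) \<in> r" "\<tau> (Suc n) \<noteq> \<tau> n"
        using climb by (auto simp: climbs_def)
      then have "\<tau> (Suc n) \<noteq> s"
        using n order_antisym by blast
      then show ?thesis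
        using \<tau>P c n order_trans by blast
    qed
  qed
  have "s \<notin> F" if s: "s \<in> P" for s
  proof -
    obtain n where "(s, \<tau> n) \<in> r"
      using s by (auto simp: P_def)
    moreover obtain Q where "Q \<in> rays T r" "\<tau> n \<in> Q" "Q \<inter> F = {}"
      using ne[of n] by (auto simp: cone_def)
    ultimately show ?thesis
      using ray_down by blast
  qed
  then have cone: "P \<in> cone (\<tau> n) F" for n
    using P \<tau>P by (auto simp: cone_def)
  have "char_fun T P \<notin> missing n \<or> char_fun T P \<in> R interior_of missing n" for n
  \<comment> \<open>The decision about \<open>A n\<close> is taken in the step from
    \<open>\<tau> n\<close> to \<open>\<tau> (Suc n)\<close>. If no node was passed, the cone at
    \<open>\<tau> (Suc n)\<close> is an open neighbourhood of \<open>P\<close> inside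
    \<open>missing n\<close>.\<close>
  proof (cases "\<exists>s\<in>A n. (s, \<tau> (Suc n)) \<in> r")
    case True
    then have "P \<inter> A n \<noteq> {}"
      by (auto simp: P_def)
    then show ?thesis
      using P by (auto simp: missing_def rays_subset)
  next
    case False
    then have avoid: "\<forall>Q\<in>cone (\<tau> (Suc n)) F. Q \<inter> A n = {}"
      using climb[of n] unfolding climbs_def by blast
    have "char_fun T ` cone (\<tau> (Suc n)) F \<subseteq> missing n"
    proof (rule image_subsetI)
      fix Q assume Q: "Q \<in> cone (\<tau> (Suc n)) F"
      then have "Q \<in> rays T r"
        by (simp add: cone_def)
      then show "char_fun T Q \<in> missing n"
        using bspec[OF avoid Q] by (simp add: missing_def topspace_ray_space rays_subset)
    qed
    moreover have "openin R (char_fun T ` cone (\<tau> (Suc n)) F)"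
      using openin_cone assms(1,2) order_carrier[OF t] by simp
    ultimately have "char_fun T ` cone (\<tau> (Suc n)) F \<subseteq> R interior_of missing n"
      by (rule interior_of_maximal)
    then show ?thesis
      using imageI[OF cone] by (intro disjI2) (rule subsetD)
  qed
  then have tame: "char_fun T P \<in> tame_rays"
    using P by (simp add: tame_rays_def topspace_ray_space)
  have "t \<in> P"
    using ray_down[OF P \<tau>P t] .
  then have "P \<in> cone t F"
    using cone by (simp add: cone_def)
  then show ?thesis
    using tame by (rule that)
qed

lemma closure_of_tame_rays: "R closure_of tame_rays = topspace R"
  unfolding dense_intersects_open
proof (intro allI impI)
  fix U assume "openin R U \<and> U \<noteq> {}"
  then obtain f where f: "openin R U" "f \<in> U"
    by blast
  obtain t F where F: "finite F" "F \<subseteq> T" "cone t F \<noteq> {}" "char_fun T ` cone t F \<subseteq> U"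
    by (rule cone_neighbourhood[OF f])
  obtain P where P: "P \<in> cone t F" "char_fun T P \<in> tame_rays"
    by (rule tame_ray_in_cone[OF F(1,2,3)])
  have "char_fun T P \<in> U"
    using F(4) imageI[OF P(1)] by (rule subsetD)
  then show "tame_rays \<inter> U \<noteq> {}"
    using P(2) by blast
qed

end

theorem proposition2p21:
  fixes T :: "'a set" and r :: "'a rel"
  assumes "special_tree T r"
  shows "\<exists>D. D \<subseteq> topspace (ray_space T r) \<and>
             ray_space T r closure_of D = topspace (ray_space T r) \<and>
             completely_metrizable_space (subtopology (ray_space T r) D)"
proof -
  obtain \<A> where \<A>: "countable \<A>" "\<forall>A\<in>\<A>. antichain_in T r A" "\<Union>\<A> = T"
    using assms by (auto simp: special_tree_def)
  \<comment> \<open>Adding the empty antichain makes the family nonempty, so that it can be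
    enumerated by \<open>nat\<close>, and leaves its union unchanged.\<close>
  obtain A :: "nat \<Rightarrow> 'a set" where A: "range A = insert {} \<A>"
    using \<A>(1) uncountable_def by (metis countable_insert insert_not_empty)
  interpret antichain_cover T r A
  proof
    show "partial_order_on T r"
      using assms by (simp add: special_tree_def is_tree_def)
    show "antichain_in T r (A n)" for n
      using A \<A>(2) by (metis insert_iff rangeI antichain_in_def empty_iff empty_subsetI)
    show "(\<Union>n. A n) = T"
      using A \<A>(3) by simp
  qed
  show ?thesis
    using closure_of_tame_rays completely_metrizable_tame_rays gdelta_in_subset[OF gdelta_in_tame_rays]
    by blast
qed

end
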